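(* Let $m_1,m_2,m_3>0$ and set $M=m_1+m_2+m_3$, $M_2=m_1m_2+m_2m_3+m_3m_1$, $M_3=m_1m_2m_3$. For the family of all relative equilibria of the Newtonian 3-body problem in $\mathbb{R}^4$ whose configuration is an equilateral triangle, the scaled energy is constant, $$h=h_L=-\tfrac12\,\frac{M_2^3}{M},$$ and the scaled momentum $k$ ranges over the interval $$k\in\Big[0,\ \tfrac34\,\frac{M_3M}{M_2^2}\Big].$$
   Context: The bodies have positions $q_i\in\mathbb{R}^4$ and momenta $p_i=m_i\dot q_i$, centre of mass at rest at the origin ($\sum m_iq_i=0$, $\sum p_i=0$). The energy is $H=\frac12\sum_i|p_i|^2/m_i-\sum_{i<j}m_im_j/|q_i-q_j|$. A relative equilibrium is a solution $q_i(t)=\exp(\Omega t)\xi_i$ with $\Omega$ a constant antisymmetric $4\times4$ matrix and $\xi_i\in\mathbb{R}^4$ constant, i.e. $\Omega^2\xi_i=\sum_{j\ne i}m_j(\xi_j-\xi_i)/|\xi_j-\xi_i|^3$ for $i=1,2,3$. It is equilateral if $|\xi_i-\xi_j|=r$ for all $i\neq j$, for some $r>0$. The angular momentum is the antisymmetric matrix $L=\sum_i(q_ip_i^t-p_iq_i^t)$; put $\ell^2=\frac12\mathrm{Tr}(LL^t)$ and let $\mathcal{P}$ be the Pfaffian of $L$, $\mathcal{P}^2=\det L$. The scale-invariant energy and momentum are $$h=H(\ell^2+2|\mathcal{P}|),\qquad k=\frac{|\mathcal{P}|}{\ell^2+2|\mathcal{P}|}.$$ *)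

theory Defs
  imports "HOL-Analysis.Analysis"
begin

text \<open>
  Bodies are indexed by the numeral type \<open>3\<close>, with elements \<open>1\<close>, \<open>2\<close> and \<open>3 = 0\<close>; vectors and
  matrices of \<open>real^4\<close> are indexed by the numeral type \<open>4\<close>, with \<open>4 = 0\<close>. A configuration is a
  function \<open>3 \<Rightarrow> real^4\<close> and a motion is a function \<open>real \<Rightarrow> 3 \<Rightarrow> real^4\<close> of time.
\<close>

text \<open>
  The powers are iterated matrix products: \<open>*\<close> and \<open>^\<close> on \<open>real^'n^'n\<close> are componentwise.
\<close>

definition matrix_exp :: "real^'n^'n \<Rightarrow> real^'n^'n" where
  "matrix_exp A = (\<Sum>k. (1 / fact k) *\<^sub>R (((**) A ^^ k) (mat 1)))"

definition momentum :: "(3 \<Rightarrow> real) \<Rightarrow> (real \<Rightarrow> 3 \<Rightarrow> real^4) \<Rightarrow> real \<Rightarrow> 3 \<Rightarrow> real^4" where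
  "momentum m q t i = m i *\<^sub>R vector_derivative (\<lambda>s. q s i) (at t)"

definition energy :: "(3 \<Rightarrow> real) \<Rightarrow> (3 \<Rightarrow> real^4) \<Rightarrow> (3 \<Rightarrow> real^4) \<Rightarrow> real" where
  "energy m x p =
     1/2 * (\<Sum>i\<in>UNIV. (norm (p i))\<^sup>2 / m i)
     - (\<Sum>(i, j)\<in>{(i, j). i < j}. m i * m j / norm (x i - x j))"

definition angular_momentum :: "(3 \<Rightarrow> real^4) \<Rightarrow> (3 \<Rightarrow> real^4) \<Rightarrow> real^4^4" where
  "angular_momentum x p =
     (\<Sum>i\<in>UNIV. (columnvector (x i) :: real^1^4) ** rowvector (p i)
            - (columnvector (p i) :: real^1^4) ** rowvector (x i))"

definition pfaffian4 :: "real^4^4 \<Rightarrow> real" where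
  "pfaffian4 A = A$1$2 * A$3$4 - A$1$3 * A$2$4 + A$1$4 * A$2$3"

lemma antisymmetric_entry:
  fixes A :: "real^'n^'n"
  assumes "transpose A = - A"
  shows "A$i$j = - A$j$i"
proof -
  have "transpose A $ j $ i = (- A) $ j $ i" using assms by simp
  then show ?thesis by (simp add: transpose_def)
qed

lemma det_4:
  fixes A :: "real^4^4"
  shows "det A =
    A$1$1*A$2$2*A$3$3*A$4$4 - A$1$1*A$2$2*A$3$4*A$4$3 - A$1$1*A$2$3*A$3$2*A$4$4
  + A$1$1*A$2$3*A$3$4*A$4$2 + A$1$1*A$2$4*A$3$2*A$4$3 - A$1$1*A$2$4*A$3$3*A$4$2
  - A$1$2*A$2$1*A$3$3*A$4$4 + A$1$2*A$2$1*A$3$4*A$4$3 + A$1$2*A$2$3*A$3$1*A$4$4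
  - A$1$2*A$2$3*A$3$4*A$4$1 - A$1$2*A$2$4*A$3$1*A$4$3 + A$1$2*A$2$4*A$3$3*A$4$1
  + A$1$3*A$2$1*A$3$2*A$4$4 - A$1$3*A$2$1*A$3$4*A$4$2 - A$1$3*A$2$2*A$3$1*A$4$4
  + A$1$3*A$2$2*A$3$4*A$4$1 + A$1$3*A$2$4*A$3$1*A$4$2 - A$1$3*A$2$4*A$3$2*A$4$1
  - A$1$4*A$2$1*A$3$2*A$4$3 + A$1$4*A$2$1*A$3$3*A$4$2 + A$1$4*A$2$2*A$3$1*A$4$3
  - A$1$4*A$2$2*A$3$3*A$4$1 - A$1$4*A$2$3*A$3$1*A$4$2 + A$1$4*A$2$3*A$3$2*A$4$1"
proof -
  have f1234: "finite {2::4, 3, 4}" "1 \<notin> {2::4, 3, 4}" by auto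
  have f234: "finite {3::4, 4}" "2 \<notin> {3::4, 4}" by auto
  have f34: "finite {4::4}" "3 \<notin> {4::4}" by auto
  show ?thesis
    unfolding det_def UNIV_4
    unfolding sum_over_permutations_insert[OF f1234]
    unfolding sum_over_permutations_insert[OF f234]
    unfolding sum_over_permutations_insert[OF f34]
    unfolding permutes_sing
    by (simp add: sign_swap_id permutation_swap_id sign_compose sign_id permutation_compose
        Transposition.transpose_def)
qed

lemma pfaffian4_square:
  assumes "transpose A = - A"
  shows "(pfaffian4 A)\<^sup>2 = det A"
proof -
  note as = antisymmetric_entry[OF assms]
  have d: "A$i$i = 0" for i using as[of i i] by simp
  have e: "A$2$1 = - A$1$2" "A$3$1 = - A$1$3" "A$4$1 = - A$1$4"
    "A$3$2 = - A$2$3" "A$4$2 = - A$2$4" "A$4$3 = - A$3$4"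
    by (rule as)+
  show ?thesis
    unfolding det_4 pfaffian4_def e d by algebra
qed

definition angular_momentum_sq :: "(3 \<Rightarrow> real^4) \<Rightarrow> (3 \<Rightarrow> real^4) \<Rightarrow> real" where
  "angular_momentum_sq x p =
     1/2 * trace (angular_momentum x p ** transpose (angular_momentum x p))"

definition scaled_energy :: "(3 \<Rightarrow> real) \<Rightarrow> (3 \<Rightarrow> real^4) \<Rightarrow> (3 \<Rightarrow> real^4) \<Rightarrow> real" where
  "scaled_energy m x p =
     energy m x p * (angular_momentum_sq x p + 2 * \<bar>pfaffian4 (angular_momentum x p)\<bar>)"

definition scaled_momentum :: "(3 \<Rightarrow> real^4) \<Rightarrow> (3 \<Rightarrow> real^4) \<Rightarrow> real" where
  "scaled_momentum x p =
     \<bar>pfaffian4 (angular_momentum x p)\<bar>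
     / (angular_momentum_sq x p + 2 * \<bar>pfaffian4 (angular_momentum x p)\<bar>)"

definition three_body_solution :: "(3 \<Rightarrow> real) \<Rightarrow> (real \<Rightarrow> 3 \<Rightarrow> real^4) \<Rightarrow> bool" where
  "three_body_solution m q \<longleftrightarrow>
     (\<forall>t i j. i \<noteq> j \<longrightarrow> q t i \<noteq> q t j) \<and>
     (\<forall>t i. (\<lambda>s. q s i) differentiable (at t)) \<and>
     (\<forall>t i. ((\<lambda>s. vector_derivative (\<lambda>u. q u i) (at s)) has_vector_derivative
        (\<Sum>j\<in>UNIV - {i}. (m j / norm (q t j - q t i) ^ 3) *\<^sub>R (q t j - q t i))) (at t))"

definition centred :: "(3 \<Rightarrow> real) \<Rightarrow> (real \<Rightarrow> 3 \<Rightarrow> real^4) \<Rightarrow> bool" where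
  "centred m q \<longleftrightarrow>
     (\<forall>t. (\<Sum>i\<in>UNIV. m i *\<^sub>R q t i) = 0 \<and> (\<Sum>i\<in>UNIV. momentum m q t i) = 0)"

definition rigid_motion :: "real^4^4 \<Rightarrow> (3 \<Rightarrow> real^4) \<Rightarrow> real \<Rightarrow> 3 \<Rightarrow> real^4" where
  "rigid_motion \<Omega> \<xi> t i = matrix_exp (t *\<^sub>R \<Omega>) *v \<xi> i"

definition relative_equilibrium :: "(3 \<Rightarrow> real) \<Rightarrow> real^4^4 \<Rightarrow> (3 \<Rightarrow> real^4) \<Rightarrow> bool" where
  "relative_equilibrium m \<Omega> \<xi> \<longleftrightarrow>
     transpose \<Omega> = - \<Omega> \<and>
     three_body_solution m (rigid_motion \<Omega> \<xi>) \<and>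
     centred m (rigid_motion \<Omega> \<xi>)"

definition equilateral :: "(3 \<Rightarrow> real^4) \<Rightarrow> bool" where
  "equilateral \<xi> \<longleftrightarrow> (\<exists>r>0. \<forall>i j. i \<noteq> j \<longrightarrow> norm (\<xi> i - \<xi> j) = r)"

end

theory Submission
  imports Defs
begin

text \<open>
  In an equilateral triangle of side \<open>r\<close> with centre of mass \<open>0\<close>, the Newtonian acceleration of each
  body is \<open>- w\<close> times its position, where \<open>w = M / r\<^sup>3\<close>. Hence the triangle moves as a relative
  equilibrium exactly when \<open>\<Omega>\<^sup>2 = - w\<close> on the positions. In \<open>real^4\<close> this does not force the triangle
  to turn in its own plane: \<open>\<Omega>\<close> may carry the positions out of that plane by any angle, and this angle
  is the only freedom that the scaled quantities could see.

  Two vectors are enough to describe the motion, the side \<open>d = x\<^sub>2 - x\<^sub>1\<close> and the position \<open>y = x\<^sub>3\<close>. Sums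
  over the three bodies diagonalise in them (\<open>sum_bilinear_jacobi\<close>), so that
  \<open>L = \<mu> (d \<and> \<Omega> d) + \<nu> (y \<and> \<Omega> y)\<close> with positive \<open>\<mu>\<close> and \<open>\<nu>\<close>. All inner products among \<open>d\<close>, \<open>\<Omega> d\<close>, \<open>y\<close>, \<open>\<Omega> y\<close>
  are determined by the triangle, by \<open>w\<close> and by the single number \<open>c = \<langle>\<Omega> d, y\<rangle>\<close>. The norm of \<open>L\<close>
  and its Pfaffian follow (the latter is \<open>\<mu> \<nu>\<close> times the determinant of the four vectors, whose square
  is a Gram determinant):
  \<open>\<ell>\<^sup>2 = w (\<mu>\<^sup>2 \<bar>d\<bar>\<^sup>4 + \<nu>\<^sup>2 \<bar>y\<bar>\<^sup>4) + 2 \<mu> \<nu> (w \<langle>d, y\<rangle>\<^sup>2 + c\<^sup>2)\<close> and \<open>\<bar>Pf L\<bar> = \<mu> \<nu> (w G - c\<^sup>2)\<close>, where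
  \<open>G = \<bar>d\<bar>\<^sup>2 \<bar>y\<bar>\<^sup>2 - \<langle>d, y\<rangle>\<^sup>2\<close>. In \<open>\<ell>\<^sup>2 + 2 \<bar>Pf L\<bar>\<close> the number \<open>c\<close> cancels, and what remains is \<open>w\<close> times
  the square of the moment of inertia (\<open>total_momentum\<close>). This makes \<open>h\<close> constant, and it makes \<open>k\<close>
  equal to \<open>(1 - c\<^sup>2 / (w G))\<close> times its claimed maximum (\<open>scaled_momentum_eq\<close>). The Cauchy-Schwarz
  inequality gives \<open>c\<^sup>2 \<le> w G\<close> (\<open>rotating_pair_area\<close>), so \<open>k\<close> lies in the interval.

  Conversely, left multiplication by an imaginary quaternion of norm \<open>sqrt w\<close> squares to \<open>- w\<close> on all
  of \<open>real^4\<close>, hence turns a centred equilateral triangle into a relative equilibrium, and rotating the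
  quaternion takes \<open>c\<^sup>2 / (w G)\<close> through all of \<open>[0, 1]\<close> (\<open>kaehler_centred_triangle\<close>).

  The motion is given by a matrix exponential, and of this only two facts matter: it solves
  \<open>q' = \<Omega> q\<close> (\<open>matrix_exp_flow\<close>), and inner products of two such solutions are constant because \<open>\<Omega>\<close> is
  antisymmetric (\<open>inner_flow_const\<close>). Both directions therefore reduce from time \<open>t\<close> to time \<open>0\<close>.
\<close>

section \<open>The flow of a matrix\<close>

abbreviation matrix_power :: "real^'n^'n \<Rightarrow> nat \<Rightarrow> real^'n^'n" where
  "matrix_power A k \<equiv> ((**) A ^^ k) (mat 1)"

lemma matrix_power_scaleR: "matrix_power (t *\<^sub>R A) k = t ^ k *\<^sub>R matrix_power A k"
  by (induction k) (simp_all add: matrix_scalar_ac scalar_matrix_assoc [symmetric])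

text \<open>
  Submultiplicativity of the operator norm bounds the entries of the powers geometrically, and so the
  exponential series of the norm dominates that of the matrix entry by entry.
\<close>

lemma norm_matrix_power_mult_le:
  "norm (matrix_power A k *v x) \<le> onorm ((*v) A) ^ k * norm x"
proof (induction k)
  case (Suc k)
  have bl: "bounded_linear ((*v) A)" by (rule matrix_vector_mul_bounded_linear)
  have "norm (matrix_power A (Suc k) *v x) = norm (A *v (matrix_power A k *v x))"
    by (simp add: matrix_vector_mul_assoc)
  also have "\<dots> \<le> onorm ((*v) A) * norm (matrix_power A k *v x)"
    by (rule onorm [OF bl])
  also have "\<dots> \<le> onorm ((*v) A) * (onorm ((*v) A) ^ k * norm x)"
    by (rule mult_left_mono [OF Suc.IH onorm_pos_le [OF bl]])
  finally show ?case by (simp add: mult.assoc)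
qed simp

lemma abs_matrix_power_entry_le: "\<bar>matrix_power A k $ i $ j\<bar> \<le> onorm ((*v) A) ^ k"
proof -
  have "matrix_power A k $ i $ j = (matrix_power A k *v axis j 1) $ i"
    by (simp add: matrix_vector_mult_basis column_def)
  also have "\<bar>\<dots>\<bar> \<le> norm (matrix_power A k *v axis j 1)"
    by (rule component_le_norm_cart)
  also have "\<dots> \<le> onorm ((*v) A) ^ k"
    using norm_matrix_power_mult_le [where A = A and k = k and x = "axis j 1"] by simp
  finally show ?thesis .
qed

lemma summable_matrix_exp_entry:
  "summable (\<lambda>k. matrix_power A k $ i $ j / fact k * t ^ k)"
proof (rule summable_comparison_test')
  show "summable (\<lambda>k. (onorm ((*v) A) * \<bar>t\<bar>) ^ k /\<^sub>R fact k)"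
    by (rule summable_exp_generic)
  show "norm (matrix_power A k $ i $ j / fact k * t ^ k) \<le> (onorm ((*v) A) * \<bar>t\<bar>) ^ k /\<^sub>R fact k"
    if "0 \<le> k" for k
    using mult_right_mono [OF abs_matrix_power_entry_le [where A = A and k = k and i = i and j = j],
        of "\<bar>t\<bar> ^ k"]
    by (simp add: abs_mult power_abs power_mult_distrib divide_simps)
qed

lemma sums_componentwise:
  fixes f :: "nat \<Rightarrow> 'a::real_normed_vector ^ 'n"
  assumes "\<And>i. (\<lambda>k. f k $ i) sums (l $ i)"
  shows "f sums l"
  using assms unfolding sums_def by (intro vec_tendstoI) simp

text \<open>
  Every entry of the exponential is a real power series in \<open>t\<close>, so that it can be differentiated
  term by term.
\<close>

lemma matrix_exp_entry:
  "matrix_exp (t *\<^sub>R A) $ i $ j = (\<Sum>k. matrix_power A k $ i $ j / fact k * t ^ k)"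
proof -
  have "(\<lambda>k. (1 / fact k) *\<^sub>R matrix_power (t *\<^sub>R A) k) sums
      (\<chi> i j. \<Sum>k. matrix_power A k $ i $ j / fact k * t ^ k)"
  proof (intro sums_componentwise)
    fix i j
    show "(\<lambda>k. ((1 / fact k) *\<^sub>R matrix_power (t *\<^sub>R A) k) $ i $ j) sums
        ((\<chi> i j. \<Sum>k. matrix_power A k $ i $ j / fact k * t ^ k) $ i $ j)"
      using summable_sums [OF summable_matrix_exp_entry [where A = A and i = i and j = j and t = t]]
      by (simp add: matrix_power_scaleR mult.commute)
  qed
  then show ?thesis
    unfolding matrix_exp_def by (simp add: sums_iff)
qed

lemma matrix_exp_entry_deriv:
  "((\<lambda>t. matrix_exp (t *\<^sub>R A) $ i $ j) has_real_derivative (A ** matrix_exp (t *\<^sub>R A)) $ i $ j) (at t)"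
proof -
  let ?c = "\<lambda>i k. matrix_power A k $ i $ j / fact k"
  \<comment> \<open>Differentiation shifts the power of \<open>A\<close> by one; the extra factor is split off on the left.\<close>
  have diffs: "diffs (?c i) k * t ^ k = (\<Sum>l\<in>UNIV. A $ i $ l * (?c l k * t ^ k))" for k
  proof -
    have "diffs (?c i) k = matrix_power A (Suc k) $ i $ j / fact k"
      by (simp add: diffs_def del: of_nat_Suc funpow.simps)
    then show ?thesis
      by (simp add: matrix_matrix_mult_def sum_divide_distrib sum_distrib_right mult.assoc)
  qed
  have "((\<lambda>t. \<Sum>k. ?c i k * t ^ k) has_real_derivative (\<Sum>k. diffs (?c i) k * t ^ k)) (at t)"
    by (rule termdiffs_strong_converges_everywhere [OF summable_matrix_exp_entry])
  also have "(\<Sum>k. diffs (?c i) k * t ^ k) = (\<Sum>l\<in>UNIV. \<Sum>k. A $ i $ l * (?c l k * t ^ k))"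
    unfolding diffs by (rule suminf_sum) (intro summable_mult summable_matrix_exp_entry)
  also have "\<dots> = (A ** matrix_exp (t *\<^sub>R A)) $ i $ j"
  proof -
    have "(\<Sum>k. A $ i $ l * (?c l k * t ^ k)) = A $ i $ l * matrix_exp (t *\<^sub>R A) $ l $ j" for l
      unfolding matrix_exp_entry by (rule suminf_mult [OF summable_matrix_exp_entry])
    then show ?thesis
      by (simp add: matrix_matrix_mult_def)
  qed
  finally show ?thesis unfolding matrix_exp_entry .
qed

lemma has_vector_derivative_vec_nth:
  fixes f :: "real \<Rightarrow> real ^ 'n"
  assumes "\<And>i. ((\<lambda>t. f t $ i) has_real_derivative f' $ i) (at t)"
  shows "(f has_vector_derivative f') (at t)"
  unfolding has_vector_derivative_def
  by (subst has_derivative_componentwise_within)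
    (use assms in \<open>auto simp: Basis_vec_def inner_axis
      has_real_derivative_iff_has_vector_derivative has_vector_derivative_def\<close>)

lemma matrix_exp_flow:
  "((\<lambda>t. matrix_exp (t *\<^sub>R A) *v x) has_vector_derivative A *v (matrix_exp (t *\<^sub>R A) *v x)) (at t)"
proof (rule has_vector_derivative_vec_nth)
  fix i
  have "((\<lambda>t. \<Sum>j\<in>UNIV. matrix_exp (t *\<^sub>R A) $ i $ j * x $ j) has_real_derivative
      (\<Sum>j\<in>UNIV. (A ** matrix_exp (t *\<^sub>R A)) $ i $ j * x $ j)) (at t)"
    by (intro DERIV_sum DERIV_cmult_right matrix_exp_entry_deriv)
  then show "((\<lambda>t. (matrix_exp (t *\<^sub>R A) *v x) $ i) has_real_derivative
      (A *v (matrix_exp (t *\<^sub>R A) *v x)) $ i) (at t)"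
    by (simp add: matrix_vector_mul_assoc) (simp add: matrix_vector_mult_def)
qed

lemma matrix_exp_zero: "matrix_exp 0 = (mat 1 :: real^'n^'n)"
proof -
  \<comment> \<open>The entry formula applies to scaled matrices only, hence \<open>0 *\<^sub>R 0\<close>.\<close>
  have "matrix_exp (0 *\<^sub>R (0::real^'n^'n)) $ i $ j = (mat 1 :: real^'n^'n) $ i $ j" for i j
    by (simp only: matrix_exp_entry powser_zero) simp
  then show ?thesis by (simp add: vec_eq_iff)
qed

lemma antisymmetric_inner:
  fixes A :: "real^'n^'n"
  assumes "transpose A = - A"
  shows "(A *v x) \<bullet> y = - (x \<bullet> (A *v y))"
proof -
  have "(A *v x) \<bullet> y = x \<bullet> (transpose A *v y)"
    by (metis dot_lmul_matrix inner_commute transpose_matrix_vector transpose_transpose)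
  moreover have "- A *v y = - (A *v y)"
    by (simp add: vec_eq_iff matrix_vector_mult_def sum_negf)
  ultimately show ?thesis by (simp add: assms)
qed

text \<open>
  The derivative is \<open>\<langle>f, A g\<rangle> + \<langle>A f, g\<rangle>\<close>, which vanishes by antisymmetry. This replaces the orthogonality
  of the exponential: distances between bodies, and later \<open>kaehler\<close>, are conserved for this reason.
\<close>

lemma inner_flow_const:
  fixes A :: "real^'n^'n" and f g :: "real \<Rightarrow> real^'n"
  assumes "transpose A = - A"
    and "\<And>t. (f has_vector_derivative A *v f t) (at t)"
    and "\<And>t. (g has_vector_derivative A *v g t) (at t)"
  shows "f t \<bullet> g t = f 0 \<bullet> g 0"
proof -
  have "((\<lambda>t. f t \<bullet> g t) has_vector_derivative f t \<bullet> (A *v g t) + (A *v f t) \<bullet> g t) (at t)" for t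
    by (rule bounded_bilinear.has_vector_derivative [OF bounded_bilinear_inner assms(2,3)])
  then have "((\<lambda>t. f t \<bullet> g t) has_real_derivative 0) (at t)" for t
    by (simp add: antisymmetric_inner [OF assms(1)] has_real_derivative_iff_has_vector_derivative)
  then show ?thesis by (rule DERIV_isconst_all [rule_format])
qed

text \<open>
  Uniqueness for the linear differential equation, read off from the conservation of the norm.
\<close>

lemma flow_eq_zero:
  fixes A :: "real^'n^'n" and f :: "real \<Rightarrow> real^'n"
  assumes "transpose A = - A" "\<And>t. (f has_vector_derivative A *v f t) (at t)" "f 0 = 0"
  shows "f t = 0"
  using inner_flow_const [OF assms(1,2,2), of t] assms(3) by simp

lemma has_vector_derivative_matrix_mult:
  fixes A B :: "real^'n^'n"
  assumes "(f has_vector_derivative v) (at t)"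
  shows "((\<lambda>s. B *v f s) has_vector_derivative B *v v) (at t)"
  by (rule bounded_linear.has_vector_derivative [OF matrix_vector_mul_bounded_linear assms])

section \<open>Bivectors and the Pfaffian\<close>

definition wedge :: "real^'n \<Rightarrow> real^'n \<Rightarrow> real^'n^'n" where
  "wedge a b = (\<chi> i j. a $ i * b $ j - b $ i * a $ j)"

lemma angular_momentum_wedge: "angular_momentum x p = (\<Sum>i\<in>UNIV. wedge (x i) (p i))"
  unfolding angular_momentum_def
  by (simp add: vec_eq_iff wedge_def matrix_matrix_mult_def columnvector_def rowvector_def)

lemma trace_mult_transpose: "trace (X ** transpose Y) = X \<bullet> (Y :: real^'n^'n)"
  by (simp add: trace_def matrix_matrix_mult_def transpose_def inner_vec_def)

text \<open>
  The Gram determinant of bivectors. The factor \<open>2\<close> appears because each bivector is counted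
  with both of its entries \<open>(i, j)\<close> and \<open>(j, i)\<close>; it cancels against the \<open>1/2\<close> in \<open>\<ell>\<^sup>2\<close>.
\<close>

lemma inner_wedge:
  "wedge a b \<bullet> wedge c d = 2 * ((a \<bullet> c) * (b \<bullet> d) - (a \<bullet> d) * (b \<bullet> c))"
proof -
  have prod: "(a \<bullet> c) * (b \<bullet> d) = (\<Sum>i\<in>UNIV. \<Sum>j\<in>UNIV. a$i * c$i * (b$j * d$j))" for a b c d :: "real^'n"
    by (simp add: inner_vec_def sum_product)
  have "wedge a b \<bullet> wedge c d =
     (\<Sum>i\<in>UNIV. \<Sum>j\<in>UNIV. (a $ i * b $ j - b $ i * a $ j) * (c $ i * d $ j - d $ i * c $ j))"
    by (simp add: wedge_def inner_vec_def)
  also have "\<dots> = (a \<bullet> c) * (b \<bullet> d) + (b \<bullet> d) * (a \<bullet> c) - (a \<bullet> d) * (b \<bullet> c) - (b \<bullet> c) * (a \<bullet> d)"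
    unfolding prod sum.distrib [symmetric] sum_subtractf [symmetric]
    by (intro sum.cong refl) algebra
  finally show ?thesis by simp
qed

lemma vector_4:
  "vector [a, b, c, d] $ (1::4) = a" "vector [a, b, c, d] $ (2::4) = b"
  "vector [a, b, c, d] $ (3::4) = c" "vector [a, b, c, d] $ (4::4) = d"
  unfolding vector_def by simp_all

text \<open>
  The Pfaffian is half of the quadratic form \<open>L \<and> L\<close>; simple bivectors are isotropic for it, so only the
  mixed term \<open>a \<and> b \<and> c \<and> d\<close> survives.
\<close>

lemma pfaffian4_two_wedges:
  "pfaffian4 (\<mu> *\<^sub>R wedge a b + \<nu> *\<^sub>R wedge c d) = \<mu> * \<nu> * det (vector [a, b, c, d])"
  unfolding pfaffian4_def det_4 by (simp add: wedge_def vector_4) algebra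

lemma det_gram:
  fixes B :: "real^'n^'n"
  shows "(det B)\<^sup>2 = det (\<chi> i j. B $ i \<bullet> B $ j)"
proof -
  have "(\<chi> i j. B $ i \<bullet> B $ j) = B ** transpose B"
    by (simp add: vec_eq_iff matrix_matrix_mult_def transpose_def inner_vec_def)
  then show ?thesis by (simp add: det_mul power2_eq_square)
qed

text \<open>
  The model case is \<open>b = A a\<close>, \<open>d = A c\<close> with \<open>A\<close> antisymmetric and \<open>A\<^sup>2 = - w\<close> on \<open>a\<close> and \<open>c\<close>. The Gram
  determinant of these four vectors is a perfect square, which is what makes the absolute value
  of the Pfaffian a polynomial in the inner products.
\<close>

lemma det_rotating_pairs:
  fixes a b c d :: "real^4"
  assumes "a \<bullet> b = 0" "c \<bullet> d = 0" "b \<bullet> b = w * (a \<bullet> a)" "d \<bullet> d = w * (c \<bullet> c)"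
    "b \<bullet> d = w * (a \<bullet> c)" "a \<bullet> d = - (b \<bullet> c)"
  shows "(det (vector [a, b, c, d]))\<^sup>2 = (w * ((a \<bullet> a) * (c \<bullet> c) - (a \<bullet> c)\<^sup>2) - (b \<bullet> c)\<^sup>2)\<^sup>2"
proof -
  have "b \<bullet> a = 0" "d \<bullet> c = 0" "d \<bullet> b = w * (a \<bullet> c)" "d \<bullet> a = - (b \<bullet> c)" "c \<bullet> a = a \<bullet> c" "c \<bullet> b = b \<bullet> c"
    using assms by (simp_all add: inner_commute)
  note i = this assms
  show ?thesis
    unfolding det_gram unfolding det_4 by (simp add: vector_4 i) algebra
qed

text \<open>
  The Cauchy-Schwarz inequality for \<open>b\<close> and the part of \<open>c\<close> orthogonal to \<open>a\<close>; \<open>b\<close> being orthogonal to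
  \<open>a\<close>, passing to that part loses nothing of \<open>\<langle>b, c\<rangle>\<close>.
\<close>

lemma rotating_pair_area:
  fixes a b c :: "'a::real_inner"
  assumes "a \<bullet> b = 0" "b \<bullet> b = w * (a \<bullet> a)"
  shows "(b \<bullet> c)\<^sup>2 \<le> w * ((a \<bullet> a) * (c \<bullet> c) - (a \<bullet> c)\<^sup>2)"
proof (cases "a = 0")
  case True
  then show ?thesis using assms by simp
next
  case False
  \<comment> \<open>The component of \<open>c\<close> orthogonal to \<open>a\<close>, times \<open>\<langle>a, a\<rangle>\<close> to avoid a division.\<close>
  define z where "z = (a \<bullet> a) *\<^sub>R c - (a \<bullet> c) *\<^sub>R a"
  have "b \<bullet> z = (a \<bullet> a) * (b \<bullet> c)"
    using assms(1) by (simp add: z_def inner_diff_right inner_commute)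
  moreover have "z \<bullet> z = (a \<bullet> a) * ((a \<bullet> a) * (c \<bullet> c) - (a \<bullet> c)\<^sup>2)"
    by (simp add: z_def inner_diff_left inner_diff_right inner_commute power2_eq_square algebra_simps)
  moreover have "(b \<bullet> z)\<^sup>2 \<le> (b \<bullet> b) * (z \<bullet> z)"
    by (rule Cauchy_Schwarz_ineq)
  ultimately have "(a \<bullet> a)\<^sup>2 * (b \<bullet> c)\<^sup>2 \<le> (a \<bullet> a)\<^sup>2 * (w * ((a \<bullet> a) * (c \<bullet> c) - (a \<bullet> c)\<^sup>2))"
    by (simp add: assms(2) power2_eq_square mult_ac)
  then show ?thesis using False by simp
qed

section \<open>Three bodies with centre of mass at the origin\<close>

text \<open>
  The order of the index type starts with \<open>3 = 0\<close>, so the increasing pairs are \<open>(3, 1)\<close>, \<open>(3, 2)\<close> and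
  \<open>(1, 2)\<close>.
\<close>

lemma less_3: "(i::3) < j \<longleftrightarrow> i \<noteq> j \<and> j \<noteq> 3 \<and> (i = 3 \<or> i = 1 \<and> j = 2)"
proof -
  have R: "Rep_bit1 (1::3) = 1" "Rep_bit1 (2::3) = 2" "Rep_bit1 (3::3) = 0"
    by (simp_all add: bit1.Rep_numeral bit1.Rep_1)
  have l: "(1::3) < 2" "(3::3) < 1" "(3::3) < 2"
    unfolding less_bit1_def R by simp_all
  note l' = l[THEN less_not_sym]
  show ?thesis
    using exhaust_3 [of i] exhaust_3 [of j] by (elim disjE) (use l l' in simp_all)
qed

lemma sum_pairs_3:
  fixes f :: "3 \<Rightarrow> 3 \<Rightarrow> real"
  shows "(\<Sum>(i, j)\<in>{(i, j). i < j}. f i j) = f 1 2 + f 3 1 + f 3 2"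
proof -
  have "{(i::3, j). i < j} = {(1, 2), (3, 1), (3, 2)}"
    by (auto simp: less_3) (use exhaust_3 in blast)+
  then show ?thesis by simp
qed

text \<open>
  Jacobi coordinates. The vector from the centre of mass of bodies 1 and 2 to body 3 is a multiple
  of \<open>x\<^sub>3\<close> itself, since the total centre of mass is the origin; the weight of the last term absorbs
  that multiple. The identity serves for the angular momentum and for the moment of inertia alike.
\<close>

lemma sum_bilinear_jacobi:
  fixes B :: "'a::real_vector \<Rightarrow> 'a \<Rightarrow> 'b::real_vector"
  assumes "bilinear B" and nz: "m\<^sub>1 + m\<^sub>2 \<noteq> 0"
    and cm: "m\<^sub>1 *\<^sub>R x\<^sub>1 + m\<^sub>2 *\<^sub>R x\<^sub>2 + m\<^sub>3 *\<^sub>R x\<^sub>3 = 0"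
  shows "m\<^sub>1 *\<^sub>R B x\<^sub>1 x\<^sub>1 + m\<^sub>2 *\<^sub>R B x\<^sub>2 x\<^sub>2 + m\<^sub>3 *\<^sub>R B x\<^sub>3 x\<^sub>3 =
    (m\<^sub>1 * m\<^sub>2 / (m\<^sub>1 + m\<^sub>2)) *\<^sub>R B (x\<^sub>2 - x\<^sub>1) (x\<^sub>2 - x\<^sub>1)
    + (m\<^sub>3 * (m\<^sub>1 + m\<^sub>2 + m\<^sub>3) / (m\<^sub>1 + m\<^sub>2)) *\<^sub>R B x\<^sub>3 x\<^sub>3"
proof -
  define s d where "s = m\<^sub>1 + m\<^sub>2" and "d = x\<^sub>2 - x\<^sub>1"
  have s: "s \<noteq> 0" using nz by (simp add: s_def)
  have x2: "x\<^sub>2 = d + x\<^sub>1" by (simp add: d_def)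
  have "s *\<^sub>R x\<^sub>1 = - (m\<^sub>2 *\<^sub>R d + m\<^sub>3 *\<^sub>R x\<^sub>3)"
    using cm unfolding s_def x2 by (simp add: algebra_simps eq_neg_iff_add_eq_0)
  then have "(1 / s) *\<^sub>R (s *\<^sub>R x\<^sub>1) = (1 / s) *\<^sub>R - (m\<^sub>2 *\<^sub>R d + m\<^sub>3 *\<^sub>R x\<^sub>3)" by simp
  then have x1: "x\<^sub>1 = (- m\<^sub>2 / s) *\<^sub>R d + (- m\<^sub>3 / s) *\<^sub>R x\<^sub>3"
    using s by (simp add: scaleR_diff_right)
  have "x\<^sub>2 = (1 - m\<^sub>2 / s) *\<^sub>R d + (- m\<^sub>3 / s) *\<^sub>R x\<^sub>3"
    unfolding x2 by (subst x1) (simp add: scaleR_diff_left)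
  also have "1 - m\<^sub>2 / s = m\<^sub>1 / s" using s by (simp add: s_def field_simps)
  finally have x2': "x\<^sub>2 = (m\<^sub>1 / s) *\<^sub>R d + (- m\<^sub>3 / s) *\<^sub>R x\<^sub>3" .
  have expand: "B (p *\<^sub>R d + q *\<^sub>R x\<^sub>3) (p *\<^sub>R d + q *\<^sub>R x\<^sub>3) =
      (p * p) *\<^sub>R B d d + (p * q) *\<^sub>R (B d x\<^sub>3 + B x\<^sub>3 d) + (q * q) *\<^sub>R B x\<^sub>3 x\<^sub>3" for p q
    by (simp add: bilinear_ladd [OF assms(1)] bilinear_radd [OF assms(1)]
        bilinear_lmul [OF assms(1)] bilinear_rmul [OF assms(1)] scaleR_add_right mult.commute)
  have collect: "m\<^sub>1 *\<^sub>R (a\<^sub>1 *\<^sub>R u + b\<^sub>1 *\<^sub>R v + c\<^sub>1 *\<^sub>R z) + m\<^sub>2 *\<^sub>R (a\<^sub>2 *\<^sub>R u + b\<^sub>2 *\<^sub>R v + c\<^sub>2 *\<^sub>R z) + m\<^sub>3 *\<^sub>R z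
      = (m\<^sub>1 * a\<^sub>1 + m\<^sub>2 * a\<^sub>2) *\<^sub>R u + (m\<^sub>1 * b\<^sub>1 + m\<^sub>2 * b\<^sub>2) *\<^sub>R v + (m\<^sub>1 * c\<^sub>1 + m\<^sub>2 * c\<^sub>2 + m\<^sub>3) *\<^sub>R z"
    for u v z :: 'b and a\<^sub>1 b\<^sub>1 c\<^sub>1 a\<^sub>2 b\<^sub>2 c\<^sub>2
    by (simp add: scaleR_add_left scaleR_add_right)
  have dd: "m\<^sub>1 * (- m\<^sub>2 / s * (- m\<^sub>2 / s)) + m\<^sub>2 * (m\<^sub>1 / s * (m\<^sub>1 / s)) = m\<^sub>1 * m\<^sub>2 / s"
    using s by (simp add: field_simps) (simp add: s_def algebra_simps)
  have dx: "m\<^sub>1 * (- m\<^sub>2 / s * (- m\<^sub>3 / s)) + m\<^sub>2 * (m\<^sub>1 / s * (- m\<^sub>3 / s)) = 0"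
    by simp
  have xx: "m\<^sub>1 * (- m\<^sub>3 / s * (- m\<^sub>3 / s)) + m\<^sub>2 * (- m\<^sub>3 / s * (- m\<^sub>3 / s)) + m\<^sub>3 = m\<^sub>3 * (s + m\<^sub>3) / s"
    using s by (simp add: field_simps) (simp add: s_def algebra_simps)
  have "m\<^sub>1 *\<^sub>R B x\<^sub>1 x\<^sub>1 + m\<^sub>2 *\<^sub>R B x\<^sub>2 x\<^sub>2 + m\<^sub>3 *\<^sub>R B x\<^sub>3 x\<^sub>3 =
      (m\<^sub>1 * m\<^sub>2 / s) *\<^sub>R B d d + (m\<^sub>3 * (s + m\<^sub>3) / s) *\<^sub>R B x\<^sub>3 x\<^sub>3"
    unfolding x1 x2' expand collect dd dx xx by simp
  then show ?thesis by (simp add: s_def d_def)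
qed

text \<open>
  With all distances equal the law of attraction is linear, as if springs whose
  strengths are the products of the masses joined the bodies, and the centre of mass takes the place
  of the other bodies.
\<close>

lemma newton_force_equilateral:
  fixes x :: "'n::finite \<Rightarrow> 'a::real_normed_vector" and m :: "'n \<Rightarrow> real"
  assumes side: "\<And>i j. i \<noteq> j \<Longrightarrow> norm (x i - x j) = r"
    and cm: "(\<Sum>i\<in>UNIV. m i *\<^sub>R x i) = 0"
  shows "(\<Sum>j\<in>UNIV - {i}. (m j / norm (x j - x i) ^ 3) *\<^sub>R (x j - x i)) = - (sum m UNIV / r ^ 3) *\<^sub>R x i"
proof -
  have "(\<Sum>j\<in>UNIV - {i}. (m j / norm (x j - x i) ^ 3) *\<^sub>R (x j - x i))
      = (\<Sum>j\<in>UNIV - {i}. (1 / r ^ 3) *\<^sub>R (m j *\<^sub>R (x j - x i)))"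
    by (intro sum.cong refl) (use side in auto)
  also have "\<dots> = (\<Sum>j\<in>UNIV. (1 / r ^ 3) *\<^sub>R (m j *\<^sub>R (x j - x i)))"
    by (intro sum.mono_neutral_left) auto
  also have "\<dots> = (1 / r ^ 3) *\<^sub>R ((\<Sum>j\<in>UNIV. m j *\<^sub>R x j) - sum m UNIV *\<^sub>R x i)"
    unfolding scaleR_sum_right [symmetric] scaleR_diff_right sum_subtractf scaleR_sum_left ..
  finally show ?thesis using cm by simp
qed

section \<open>Invariants of a rotating equilateral triangle\<close>

text \<open>
  The conditions on positions and matrix at a single instant that characterise an equilateral
  relative equilibrium. Along a rigid motion they hold at one time exactly if they hold at all
  times (\<open>rotating_triangle_rigid_motion\<close>), so that everything below may be evaluated at any time.
\<close>

locale rotating_triangle =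
  fixes m :: "3 \<Rightarrow> real" and A :: "real^4^4" and x :: "3 \<Rightarrow> real^4" and r :: real
  assumes mass_pos: "m i > 0"
    and antisymmetric: "transpose A = - A"
    and side_pos: "r > 0"
    and side: "i \<noteq> j \<Longrightarrow> norm (x i - x j) = r"
    and centre_of_mass: "(\<Sum>i\<in>UNIV. m i *\<^sub>R x i) = 0"
    and square: "A *v (A *v x i) = - (sum m UNIV / r ^ 3) *\<^sub>R x i"
begin

definition momenta where "momenta i = m i *\<^sub>R (A *v x i)"
definition M where "M = m 1 + m 2 + m 3"
definition M\<^sub>2 where "M\<^sub>2 = m 1 * m 2 + m 2 * m 3 + m 3 * m 1"
definition M\<^sub>3 where "M\<^sub>3 = m 1 * m 2 * m 3"

text \<open>
  The square of the angular velocity.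
\<close>

definition w where "w = M / r ^ 3"

text \<open>
  The weights of \<open>base\<close> and \<open>apex\<close> in Jacobi coordinates.
\<close>

definition \<mu> where "\<mu> = m 1 * m 2 / (m 1 + m 2)"
definition \<nu> where "\<nu> = m 3 * M / (m 1 + m 2)"
definition base where "base = x 2 - x 1"
definition apex where "apex = x 3"

lemma pos: "m 1 > 0" "m 2 > 0" "m 3 > 0" "m 1 + m 2 > 0" "M > 0" "M\<^sub>2 > 0" "M\<^sub>3 > 0" "w > 0" "\<mu> > 0" "\<nu> > 0"
proof -
  show m: "m 1 > 0" "m 2 > 0" "m 3 > 0" by (rule mass_pos)+
  then show "m 1 + m 2 > 0" by simp
  from m show M: "M > 0" "M\<^sub>2 > 0" "M\<^sub>3 > 0" by (simp_all add: M_def M\<^sub>2_def M\<^sub>3_def add_pos_pos)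
  from M m show "w > 0" "\<mu> > 0" "\<nu> > 0" using side_pos by (simp_all add: w_def \<mu>_def \<nu>_def)
qed

lemma inner_A_left: "(A *v u) \<bullet> v = - (u \<bullet> (A *v v))"
  by (rule antisymmetric_inner [OF antisymmetric])

lemma square_x: "A *v (A *v x i) = - w *\<^sub>R x i"
  unfolding square w_def M_def by (simp add: sum_3)

lemma square_base: "A *v (A *v base) = - w *\<^sub>R base"
  by (simp add: base_def matrix_vector_mult_diff_distrib square_x scaleR_diff_right)

lemma sum_bilinear:
  assumes "bilinear B"
  shows "(\<Sum>i\<in>UNIV. m i *\<^sub>R B (x i) (x i)) = \<mu> *\<^sub>R B base base + \<nu> *\<^sub>R B apex apex"
  using sum_bilinear_jacobi [OF assms, of "m 1" "m 2" "x 1" "x 2" "m 3" "x 3"] centre_of_mass pos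
  by (simp add: sum_3 \<mu>_def \<nu>_def base_def apex_def M_def)

lemma angular_momentum_two_wedges:
  "angular_momentum x momenta = \<mu> *\<^sub>R wedge base (A *v base) + \<nu> *\<^sub>R wedge apex (A *v apex)"
proof -
  have "bilinear (\<lambda>u v. wedge u (A *v v))"
    unfolding bilinear_def
    by (intro conjI allI linearI)
      (simp_all add: vec_eq_iff wedge_def algebra_simps matrix_vector_right_distrib)
  moreover have "wedge (x i) (momenta i) = m i *\<^sub>R wedge (x i) (A *v x i)" for i
    by (simp add: vec_eq_iff wedge_def momenta_def algebra_simps)
  ultimately show ?thesis
    unfolding angular_momentum_wedge using sum_bilinear by simp
qed

lemma inner_A_self: "u \<bullet> (A *v u) = 0"
  using inner_A_left [of u u] by (simp add: inner_commute)

lemma inner_A_A: "A *v (A *v v) = - w *\<^sub>R v \<Longrightarrow> (A *v u) \<bullet> (A *v v) = w * (u \<bullet> v)"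
  by (simp add: inner_A_left)

text \<open>
  The centre of mass condition expresses \<open>M apex\<close> through the two sides that meet in body 3, and these
  sides enclose an angle of 60 degrees.
\<close>

lemma inner_distances:
  "base \<bullet> base = r\<^sup>2" "base \<bullet> apex = (m 1 - m 2) * r\<^sup>2 / (2 * M)"
  "apex \<bullet> apex = ((m 1)\<^sup>2 + (m 2)\<^sup>2 + m 1 * m 2) * r\<^sup>2 / M\<^sup>2"
proof -
  define u v where "u = x 3 - x 1" and "v = x 3 - x 2"
  have dd: "base \<bullet> base = r\<^sup>2" and uu: "u \<bullet> u = r\<^sup>2" and vv: "v \<bullet> v = r\<^sup>2"
    by (simp_all add: base_def u_def v_def dot_square_norm side)
  have base: "base = u - v" by (simp add: base_def u_def v_def)
  have uv: "u \<bullet> v = r\<^sup>2 / 2"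
    using dd uu vv unfolding base by (simp add: inner_diff_left inner_diff_right inner_commute)
  have "M *\<^sub>R apex = m 1 *\<^sub>R u + m 2 *\<^sub>R v + (\<Sum>i\<in>UNIV. m i *\<^sub>R x i)"
    by (simp add: sum_3 M_def apex_def u_def v_def algebra_simps)
  then have My: "M *\<^sub>R apex = m 1 *\<^sub>R u + m 2 *\<^sub>R v" by (simp add: centre_of_mass)
  have "M * (base \<bullet> apex) = (u - v) \<bullet> (M *\<^sub>R apex)" by (simp add: base)
  also have "\<dots> = (m 1 - m 2) * r\<^sup>2 / 2"
    unfolding My
    by (simp add: inner_diff_left inner_add_right uu vv uv inner_commute [of v u])
      (simp add: field_simps)
  finally show "base \<bullet> apex = (m 1 - m 2) * r\<^sup>2 / (2 * M)" using pos by (simp add: field_simps)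
  have "M\<^sup>2 * (apex \<bullet> apex) = (M *\<^sub>R apex) \<bullet> (M *\<^sub>R apex)" by (simp add: power2_eq_square)
  also have "\<dots> = ((m 1)\<^sup>2 + (m 2)\<^sup>2 + m 1 * m 2) * r\<^sup>2"
    unfolding My
    by (simp add: inner_add_left inner_add_right uu vv uv inner_commute [of v u]
        power2_eq_square field_simps)
  finally show "apex \<bullet> apex = ((m 1)\<^sup>2 + (m 2)\<^sup>2 + m 1 * m 2) * r\<^sup>2 / M\<^sup>2" using pos by (simp add: field_simps)
  show "base \<bullet> base = r\<^sup>2" by (rule dd)
qed

text \<open>
  The squared area of the parallelogram spanned by \<open>base\<close> and \<open>apex\<close>.
\<close>

definition gram where "gram = (base \<bullet> base) * (apex \<bullet> apex) - (base \<bullet> apex)\<^sup>2"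

lemma gram_eq: "gram = 3/4 * (m 1 + m 2)\<^sup>2 * r ^ 4 / M\<^sup>2"
  unfolding gram_def inner_distances using pos
  by (simp add: field_simps power2_eq_square power4_eq_xxxx)

lemma gram_pos: "gram > 0"
  using pos side_pos by (simp add: gram_eq)

definition inertia where "inertia = \<mu> * (base \<bullet> base) + \<nu> * (apex \<bullet> apex)"

lemma inertia_sum: "inertia = (\<Sum>i\<in>UNIV. m i * (x i \<bullet> x i))"
  using sum_bilinear [of "(\<bullet>)"]
  by (simp add: inertia_def bilinear_conv_bounded_bilinear bounded_bilinear_inner)

lemma inertia_eq: "inertia = M\<^sub>2 * r\<^sup>2 / M"
proof -
  have "(m 1 + m 2) * M * inertia = (m 1 * m 2 * M + m 3 * ((m 1)\<^sup>2 + (m 2)\<^sup>2 + m 1 * m 2)) * r\<^sup>2"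
  proof -
    have "(m 1 + m 2) * \<mu> = m 1 * m 2" "(m 1 + m 2) * \<nu> = m 3 * M"
        "M\<^sup>2 * (apex \<bullet> apex) = ((m 1)\<^sup>2 + (m 2)\<^sup>2 + m 1 * m 2) * r\<^sup>2"
      using pos by (simp_all add: \<mu>_def \<nu>_def inner_distances)
    then show ?thesis unfolding inertia_def inner_distances(1) by algebra
  qed
  also have "\<dots> = (m 1 + m 2) * M\<^sub>2 * r\<^sup>2"
    unfolding M\<^sub>2_def M_def by algebra
  finally have "M * inertia = M\<^sub>2 * r\<^sup>2" using pos by simp
  then show ?thesis using pos by (simp add: field_simps)
qed

text \<open>
  Where \<open>A / sqrt w\<close> is a complex structure, this is its Kaehler form on the triangle, up to scale:
  \<open>kaehler\<^sup>2 / (w * gram)\<close> is the squared cosine of the Kaehler angle of the plane of the triangle. This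
  quotient is \<open>1\<close> for rotation in the plane of the triangle and \<open>0\<close> if every body moves
  perpendicularly to that plane.
\<close>

definition kaehler where "kaehler = (A *v base) \<bullet> apex"

lemma kaehler_le: "kaehler\<^sup>2 \<le> w * gram"
  unfolding kaehler_def gram_def by (rule rotating_pair_area) (simp_all add: inner_A_self inner_A_A square_base)

lemma abs_pfaffian: "\<bar>pfaffian4 (angular_momentum x momenta)\<bar> = \<mu> * \<nu> * (w * gram - kaehler\<^sup>2)"
proof -
  have "(det (vector [base, A *v base, apex, A *v apex]))\<^sup>2 = (w * gram - kaehler\<^sup>2)\<^sup>2"
    unfolding gram_def kaehler_def
    by (rule det_rotating_pairs)
      (simp_all add: inner_A_self inner_A_A square_base square_x apex_def inner_A_left)
  then have "\<bar>det (vector [base, A *v base, apex, A *v apex])\<bar> = w * gram - kaehler\<^sup>2"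
    using kaehler_le by (auto simp: power2_eq_iff)
  then show ?thesis
    unfolding angular_momentum_two_wedges pfaffian4_two_wedges using pos by (simp add: abs_mult)
qed

lemma angular_momentum_sq_eq:
  "angular_momentum_sq x momenta = w * (\<mu>\<^sup>2 * (base \<bullet> base)\<^sup>2 + \<nu>\<^sup>2 * (apex \<bullet> apex)\<^sup>2)
    + 2 * \<mu> * \<nu> * (w * (base \<bullet> apex)\<^sup>2 + kaehler\<^sup>2)"
proof -
  have dAy: "base \<bullet> (A *v apex) = - kaehler" by (simp add: kaehler_def inner_A_left)
  have i: "base \<bullet> (A *v base) = 0" "(A *v base) \<bullet> base = 0"
    "apex \<bullet> (A *v apex) = 0" "(A *v apex) \<bullet> apex = 0"
    "(A *v base) \<bullet> (A *v base) = w * (base \<bullet> base)" "(A *v apex) \<bullet> (A *v apex) = w * (apex \<bullet> apex)"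
    "(A *v base) \<bullet> (A *v apex) = w * (base \<bullet> apex)" "(A *v apex) \<bullet> (A *v base) = w * (base \<bullet> apex)"
    "(A *v base) \<bullet> apex = kaehler" "apex \<bullet> (A *v base) = kaehler"
    "(A *v apex) \<bullet> base = - kaehler" "apex \<bullet> base = base \<bullet> apex"
    using dAy by (simp_all add: inner_A_self inner_A_A square_base square_x apex_def kaehler_def inner_commute)
  show ?thesis
    unfolding angular_momentum_sq_def trace_mult_transpose angular_momentum_two_wedges
    by (simp add: inner_add_left inner_add_right inner_wedge i dAy) (simp add: power2_eq_square algebra_simps)
qed

text \<open>
  In the combination \<open>\<ell>\<^sup>2 + 2 \<bar>Pf L\<bar>\<close> the terms with \<open>kaehler\<^sup>2\<close> and with \<open>\<langle>base, apex\<rangle>\<^sup>2\<close> cancel, and the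
  rest of the Pfaffian completes the square.
\<close>

lemma total_momentum:
  "angular_momentum_sq x momenta + 2 * \<bar>pfaffian4 (angular_momentum x momenta)\<bar> = w * inertia\<^sup>2"
  unfolding angular_momentum_sq_eq abs_pfaffian unfolding inertia_def gram_def by algebra

text \<open>
  The kinetic energy \<open>w * inertia / 2\<close> is minus half of the potential energy, as the virial theorem
  demands.
\<close>

lemma energy_eq: "energy m x momenta = - (M\<^sub>2 / (2 * r))"
proof -
  have "(norm (momenta i))\<^sup>2 / m i = w * (m i * (x i \<bullet> x i))" for i
  proof -
    have "(norm (A *v x i))\<^sup>2 = w * (x i \<bullet> x i)"
      unfolding power2_norm_eq_inner by (rule inner_A_A [OF square_x])
    then show ?thesis
      using mass_pos [of i] by (simp add: momenta_def power_mult_distrib) (simp add: power2_eq_square)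
  qed
  then have "(\<Sum>i\<in>UNIV. (norm (momenta i))\<^sup>2 / m i) = w * inertia"
    by (simp add: inertia_sum sum_distrib_left)
  moreover have "(\<Sum>(i, j)\<in>{(i, j). i < j}. m i * m j / norm (x i - x j)) = M\<^sub>2 / r"
    unfolding sum_pairs_3 by (simp add: side M\<^sub>2_def add_divide_distrib mult.commute)
  moreover have "w * inertia = M\<^sub>2 / r"
    using pos side_pos by (simp add: w_def inertia_eq field_simps power2_eq_square power3_eq_cube)
  ultimately show ?thesis by (simp add: energy_def field_simps)
qed

lemma scaled_energy_eq: "scaled_energy m x momenta = - (1/2) * (M\<^sub>2 ^ 3 / M)"
  unfolding scaled_energy_def total_momentum energy_eq inertia_eq w_def
  using pos side_pos by (simp add: field_simps power2_eq_square power3_eq_cube)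

lemma scaled_momentum_eq:
  "scaled_momentum x momenta = (1 - kaehler\<^sup>2 / (w * gram)) * (3/4 * (M\<^sub>3 * M / M\<^sub>2\<^sup>2))"
proof -
  have "scaled_momentum x momenta = \<mu> * \<nu> * (w * gram - kaehler\<^sup>2) / (w * inertia\<^sup>2)"
    unfolding scaled_momentum_def total_momentum unfolding abs_pfaffian ..
  also have "\<dots> = (1 - kaehler\<^sup>2 / (w * gram)) * (\<mu> * \<nu> * gram / inertia\<^sup>2)"
  proof -
    have "1 - kaehler\<^sup>2 / (w * gram) = (w * gram - kaehler\<^sup>2) / (w * gram)"
      using pos gram_pos by (simp add: diff_divide_distrib)
    then show ?thesis using gram_pos by simp
  qed
  also have "\<mu> * \<nu> * gram / inertia\<^sup>2 = 3/4 * (M\<^sub>3 * M / M\<^sub>2\<^sup>2)"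
  proof -
    have cancel: "u / s * (v * N / s) * (3/4 * s\<^sup>2 * r ^ 4 / N\<^sup>2) / (K * r\<^sup>2 / N)\<^sup>2 = 3/4 * (u * v * N / K\<^sup>2)"
      if "s > 0" "N > 0" "K > 0" for u v s N K :: real
      using that side_pos by (simp add: field_simps power2_eq_square power4_eq_xxxx)
    show ?thesis
      unfolding \<mu>_def \<nu>_def gram_eq inertia_eq M\<^sub>3_def by (rule cancel) (rule pos)+
  qed
  finally show ?thesis .
qed

lemma scaled_momentum_range: "scaled_momentum x momenta \<in> {0 .. 3/4 * (M\<^sub>3 * M / M\<^sub>2\<^sup>2)}"
proof -
  have "0 < 3/4 * (M\<^sub>3 * M / M\<^sub>2\<^sup>2)" using pos by simp
  moreover have "0 \<le> 1 - kaehler\<^sup>2 / (w * gram)" "1 - kaehler\<^sup>2 / (w * gram) \<le> 1"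
    using pos gram_pos kaehler_le by (simp_all add: field_simps)
  ultimately show ?thesis
    unfolding scaled_momentum_eq atLeastAtMost_iff
    by (metis mult_left_le_one_le mult_nonneg_nonneg less_imp_le)
qed

end

section \<open>Relative equilibria\<close>

lemma rigid_motion_zero: "rigid_motion \<Omega> \<xi> 0 = \<xi>"
  by (simp add: fun_eq_iff rigid_motion_def matrix_exp_zero)

lemma rigid_motion_deriv:
  "((\<lambda>s. rigid_motion \<Omega> \<xi> s i) has_vector_derivative \<Omega> *v rigid_motion \<Omega> \<xi> t i) (at t)"
  unfolding rigid_motion_def by (rule matrix_exp_flow)

lemma vector_derivative_rigid_motion:
  "vector_derivative (\<lambda>s. rigid_motion \<Omega> \<xi> s i) (at t) = \<Omega> *v rigid_motion \<Omega> \<xi> t i"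
  by (rule vector_derivative_at [OF rigid_motion_deriv])

lemma momentum_rigid_motion:
  "momentum m (rigid_motion \<Omega> \<xi>) t i = m i *\<^sub>R (\<Omega> *v rigid_motion \<Omega> \<xi> t i)"
  by (simp add: momentum_def vector_derivative_rigid_motion)

lemma rigid_motion_acceleration:
  "((\<lambda>s. vector_derivative (\<lambda>u. rigid_motion \<Omega> \<xi> u i) (at s)) has_vector_derivative
    \<Omega> *v (\<Omega> *v rigid_motion \<Omega> \<xi> t i)) (at t)"
  unfolding vector_derivative_rigid_motion by (rule has_vector_derivative_matrix_mult [OF rigid_motion_deriv])

lemma rigid_motion_diff_deriv:
  "((\<lambda>s. rigid_motion \<Omega> \<xi> s i - rigid_motion \<Omega> \<xi> s j) has_vector_derivative
    \<Omega> *v (rigid_motion \<Omega> \<xi> t i - rigid_motion \<Omega> \<xi> t j)) (at t)"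
  unfolding matrix_vector_mult_diff_distrib
  by (intro has_vector_derivative_diff rigid_motion_deriv)

lemma rigid_motion_dist:
  assumes "transpose \<Omega> = - \<Omega>"
  shows "norm (rigid_motion \<Omega> \<xi> t i - rigid_motion \<Omega> \<xi> t j) = norm (\<xi> i - \<xi> j)"
  using inner_flow_const [OF assms rigid_motion_diff_deriv rigid_motion_diff_deriv]
  by (metis norm_eq rigid_motion_zero)

lemma rotating_triangle_rigid_motion:
  assumes "rotating_triangle m \<Omega> \<xi> r"
  shows "rotating_triangle m \<Omega> (rigid_motion \<Omega> \<xi> t) r"
proof -
  interpret rotating_triangle m \<Omega> \<xi> r by fact
  let ?q = "rigid_motion \<Omega> \<xi>"
  show ?thesis
  proof
    show "norm (?q t i - ?q t j) = r" if "i \<noteq> j" for i j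
      using side [OF that] by (simp add: rigid_motion_dist [OF antisymmetric])
    have "(\<Sum>i\<in>UNIV. m i *\<^sub>R ?q t i) = matrix_exp (t *\<^sub>R \<Omega>) *v (\<Sum>i\<in>UNIV. m i *\<^sub>R \<xi> i)"
      by (simp add: rigid_motion_def sum_3 matrix_vector_right_distrib matrix_vector_mult_scaleR)
    then show "(\<Sum>i\<in>UNIV. m i *\<^sub>R ?q t i) = 0" by (simp add: centre_of_mass)
    show "\<Omega> *v (\<Omega> *v ?q t i) = - (sum m UNIV / r ^ 3) *\<^sub>R ?q t i" for i
    proof -
      let ?k = "sum m UNIV / r ^ 3"
      \<comment> \<open>The defect of the eigenvector equation is itself a solution of the flow, starting at \<open>0\<close>.\<close>
      let ?f = "\<lambda>t. \<Omega> *v (\<Omega> *v ?q t i) + ?k *\<^sub>R ?q t i"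
      have "(?f has_vector_derivative \<Omega> *v (\<Omega> *v (\<Omega> *v ?q t i)) + ?k *\<^sub>R (\<Omega> *v ?q t i)) (at t)" for t
        by (intro has_vector_derivative_add has_vector_derivative_matrix_mult rigid_motion_deriv
            bounded_linear.has_vector_derivative [OF bounded_linear_scaleR_right])
      then have "(?f has_vector_derivative \<Omega> *v ?f t) (at t)" for t
        by (simp add: matrix_vector_right_distrib matrix_vector_mult_scaleR)
      moreover have "?f 0 = 0" by (simp add: rigid_motion_zero square)
      ultimately have "?f t = 0" by (rule flow_eq_zero [OF antisymmetric])
      then show ?thesis by (simp add: eq_neg_iff_add_eq_0)
    qed
  qed (rule mass_pos antisymmetric side_pos)+
qed

text \<open>
  The acceleration of a rigid motion is \<open>\<Omega>\<^sup>2 q\<close>, and the force is linear in \<open>q\<close> for equal distances. Going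
  from left to right it suffices to compare the two at time \<open>0\<close>.
\<close>

lemma equilateral_relative_equilibrium_iff:
  assumes "\<And>i. m i > 0"
  shows "relative_equilibrium m \<Omega> \<xi> \<and> equilateral \<xi> \<longleftrightarrow> (\<exists>r. rotating_triangle m \<Omega> \<xi> r)"
proof (intro iffI conjI; (elim conjE exE)?)
  let ?q = "rigid_motion \<Omega> \<xi>"
  assume re: "relative_equilibrium m \<Omega> \<xi>" and "equilateral \<xi>"
  then obtain r where r: "r > 0" "\<And>i j. i \<noteq> j \<Longrightarrow> norm (\<xi> i - \<xi> j) = r"
    unfolding equilateral_def by blast
  have sol: "three_body_solution m ?q" and "centred m ?q" and as: "transpose \<Omega> = - \<Omega>"
    using re unfolding relative_equilibrium_def by blast+
  then have cm: "(\<Sum>i\<in>UNIV. m i *\<^sub>R \<xi> i) = 0"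
    unfolding centred_def by (metis rigid_motion_zero)
  have "\<Omega> *v (\<Omega> *v \<xi> i) = - (sum m UNIV / r ^ 3) *\<^sub>R \<xi> i" for i
  proof -
    have "((\<lambda>s. vector_derivative (\<lambda>u. ?q u i) (at s)) has_vector_derivative
        (\<Sum>j\<in>UNIV - {i}. (m j / norm (\<xi> j - \<xi> i) ^ 3) *\<^sub>R (\<xi> j - \<xi> i))) (at 0)"
      using sol unfolding three_body_solution_def by (metis (no_types, lifting) rigid_motion_zero sum.cong)
    from vector_derivative_unique_at [OF rigid_motion_acceleration this]
    have "\<Omega> *v (\<Omega> *v \<xi> i)
        = (\<Sum>j\<in>UNIV - {i}. (m j / norm (\<xi> j - \<xi> i) ^ 3) *\<^sub>R (\<xi> j - \<xi> i))"
      by (simp only: rigid_motion_zero)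
    also have "\<dots> = - (sum m UNIV / r ^ 3) *\<^sub>R \<xi> i"
      by (rule newton_force_equilateral [OF r(2) cm])
    finally show ?thesis .
  qed
  then have "rotating_triangle m \<Omega> \<xi> r"
    using assms as r cm by unfold_locales
  then show "\<exists>r. rotating_triangle m \<Omega> \<xi> r" ..
next
  fix r
  let ?q = "rigid_motion \<Omega> \<xi>"
  assume tri: "rotating_triangle m \<Omega> \<xi> r"
  then interpret rotating_triangle m \<Omega> \<xi> r .
  interpret at: rotating_triangle m \<Omega> "?q t" r for t
    by (rule rotating_triangle_rigid_motion [OF tri])
  show "equilateral \<xi>"
    unfolding equilateral_def using side side_pos by blast
  have "?q t i \<noteq> ?q t j" if "i \<noteq> j" for t i j
    using at.side [OF that, of t] side_pos by auto
  moreover have "(\<lambda>s. ?q s i) differentiable (at t)" for t i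
    using rigid_motion_deriv by (rule differentiableI_vector)
  moreover have "((\<lambda>s. vector_derivative (\<lambda>u. ?q u i) (at s)) has_vector_derivative
        (\<Sum>j\<in>UNIV - {i}. (m j / norm (?q t j - ?q t i) ^ 3) *\<^sub>R (?q t j - ?q t i))) (at t)" for t i
  proof -
    have "(\<Sum>j\<in>UNIV - {i}. (m j / norm (?q t j - ?q t i) ^ 3) *\<^sub>R (?q t j - ?q t i))
        = - (sum m UNIV / r ^ 3) *\<^sub>R ?q t i"
      using newton_force_equilateral [of "?q t" r m i] at.side [of _ _ t] at.centre_of_mass [of t]
      by blast
    also have "\<dots> = \<Omega> *v (\<Omega> *v ?q t i)" using at.square [of t i] by (rule sym)
    finally have force: "(\<Sum>j\<in>UNIV - {i}. (m j / norm (?q t j - ?q t i) ^ 3) *\<^sub>R (?q t j - ?q t i))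
        = \<Omega> *v (\<Omega> *v ?q t i)" .
    show ?thesis unfolding force by (rule rigid_motion_acceleration)
  qed
  ultimately have "three_body_solution m ?q"
    unfolding three_body_solution_def by (intro conjI allI impI)
  moreover have "(\<Sum>i\<in>UNIV. momentum m ?q t i) = \<Omega> *v (\<Sum>i\<in>UNIV. m i *\<^sub>R ?q t i)" for t
    by (simp add: momentum_rigid_motion sum_3 matrix_vector_right_distrib matrix_vector_mult_scaleR)
  then have "centred m ?q"
    unfolding centred_def by (simp add: at.centre_of_mass)
  ultimately show "relative_equilibrium m \<Omega> \<xi>"
    unfolding relative_equilibrium_def using antisymmetric by blast
qed

lemma kaehler_rigid_motion:
  assumes "rotating_triangle m \<Omega> \<xi> r"
  shows "rotating_triangle.kaehler \<Omega> (rigid_motion \<Omega> \<xi> t) = rotating_triangle.kaehler \<Omega> \<xi>"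
proof -
  interpret rotating_triangle m \<Omega> \<xi> r by fact
  interpret at: rotating_triangle m \<Omega> "rigid_motion \<Omega> \<xi> t" r
    by (rule rotating_triangle_rigid_motion) fact
  let ?f = "\<lambda>s. \<Omega> *v (rigid_motion \<Omega> \<xi> s 2 - rigid_motion \<Omega> \<xi> s 1)"
  have "(?f has_vector_derivative \<Omega> *v ?f s) (at s)" for s
    by (rule has_vector_derivative_matrix_mult [OF rigid_motion_diff_deriv])
  from inner_flow_const [OF antisymmetric this rigid_motion_deriv [of \<Omega> \<xi> 3], of t]
  have "at.kaehler = ?f 0 \<bullet> rigid_motion \<Omega> \<xi> 0 3"
    by (simp only: at.kaehler_def at.base_def at.apex_def)
  then show ?thesis
    by (simp add: rigid_motion_zero kaehler_def base_def apex_def)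
qed

section \<open>Triangles with prescribed scaled momentum\<close>

text \<open>
  Left multiplication by the quaternion \<open>a i + b j\<close>, with \<open>real^4\<close> identified with the quaternions through
  the basis \<open>1, i, j, k\<close>. For \<open>b = 0\<close> it preserves the plane of \<open>1\<close> and \<open>i\<close>, for \<open>a = 0\<close> it maps this plane
  to its orthogonal complement.
\<close>

definition quaternion_rotation :: "real \<Rightarrow> real \<Rightarrow> real^4^4" where
  "quaternion_rotation a b = vector [vector [0, -a, -b, 0], vector [a, 0, 0, b],
     vector [b, 0, 0, -a], vector [0, -b, a, 0]]"

lemma quaternion_rotation_mult:
  "quaternion_rotation a b *v v = vector
     [- a * v$2 - b * v$3, a * v$1 + b * v$4, b * v$1 - a * v$4, a * v$3 - b * v$2]"
  by (simp add: quaternion_rotation_def vec_eq_iff forall_4 vector_4 matrix_vector_mult_def sum_4)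

lemma quaternion_rotation_antisymmetric:
  "transpose (quaternion_rotation a b) = - quaternion_rotation a b"
  by (simp add: quaternion_rotation_def vec_eq_iff forall_4 vector_4 transpose_def)

lemma quaternion_rotation_square:
  "quaternion_rotation a b *v (quaternion_rotation a b *v v) = - (a\<^sup>2 + b\<^sup>2) *\<^sub>R v"
  unfolding quaternion_rotation_mult
  by (simp add: vec_eq_iff forall_4 vector_4 power2_eq_square algebra_simps)

text \<open>
  The triangle lies in the plane of the first two basis vectors, which \<open>quaternion_rotation a 0\<close>
  preserves.
\<close>

definition unit_triangle :: "3 \<Rightarrow> real^4" where
  "unit_triangle i = (if i = 1 then 0 else if i = 2 then vector [1, 0, 0, 0]
     else vector [1/2, sqrt 3 / 2, 0, 0])"

lemma unit_triangle_side:
  assumes "i \<noteq> j"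
  shows "norm (unit_triangle i - unit_triangle j) = 1"
proof -
  have "(unit_triangle i - unit_triangle j) \<bullet> (unit_triangle i - unit_triangle j) = 1"
    using assms exhaust_3 [of i] exhaust_3 [of j]
    by (auto simp: unit_triangle_def inner_vec_def sum_4 vector_4)
  then show ?thesis by (simp add: norm_eq_1)
qed

definition centred_triangle :: "(3 \<Rightarrow> real) \<Rightarrow> 3 \<Rightarrow> real^4" where
  "centred_triangle m i = unit_triangle i - (1 / sum m UNIV) *\<^sub>R (\<Sum>j\<in>UNIV. m j *\<^sub>R unit_triangle j)"

lemma rotating_triangle_exists:
  assumes pos: "\<And>i. m i > 0" and "a\<^sup>2 + b\<^sup>2 = sum m UNIV"
  shows "rotating_triangle m (quaternion_rotation a b) (centred_triangle m) 1"
proof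
  have "sum m UNIV > 0" by (intro sum_pos) (auto simp: pos)
  then show "(\<Sum>i\<in>UNIV. m i *\<^sub>R centred_triangle m i) = 0"
    unfolding centred_triangle_def scaleR_diff_right sum_subtractf scaleR_sum_left [symmetric]
    by simp
  show "norm (centred_triangle m i - centred_triangle m j) = 1" if "i \<noteq> j" for i j
    using unit_triangle_side [OF that] by (simp add: centred_triangle_def)
qed (simp_all add: pos quaternion_rotation_antisymmetric quaternion_rotation_square assms(2))

text \<open>
  Only the part \<open>a i\<close> of the quaternion keeps the plane of the triangle; there it acts as rotation by a
  right angle scaled by \<open>a\<close>, which turns the inner product into \<open>a\<close> times an oriented area.
\<close>

lemma kaehler_centred_triangle:
  assumes pos: "\<And>i. m i > 0" and ab: "a\<^sup>2 + b\<^sup>2 = sum m UNIV"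
  shows "(rotating_triangle.kaehler (quaternion_rotation a b) (centred_triangle m))\<^sup>2
    = a\<^sup>2 * rotating_triangle.gram (centred_triangle m)"
proof -
  interpret rotating_triangle m "quaternion_rotation a b" "centred_triangle m" 1
    by (rule rotating_triangle_exists [OF assms])
  have base: "base = vector [1, 0, 0, 0]"
    by (simp add: base_def centred_triangle_def unit_triangle_def)
  have "apex $ 2 = sqrt 3 / 2 * (m 1 + m 2) / M"
    using pos by (simp add: apex_def centred_triangle_def unit_triangle_def sum_3 M_def vector_4 field_simps)
  moreover have "apex $ 3 = 0"
    by (simp add: apex_def centred_triangle_def unit_triangle_def sum_3 vector_4)
  ultimately have "kaehler = a * (sqrt 3 / 2 * (m 1 + m 2) / M)"
    by (simp add: kaehler_def base quaternion_rotation_mult inner_vec_def sum_4 vector_4)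
  then show ?thesis
    by (simp add: gram_eq power_mult_distrib power_divide)
qed

lemma scaled_momentum_attained:
  assumes pos: "\<And>i. m i > 0" and "0 \<le> u" "u \<le> 1"
  shows "\<exists>\<Omega> \<xi>. relative_equilibrium m \<Omega> \<xi> \<and> equilateral \<xi> \<and>
    scaled_momentum (rigid_motion \<Omega> \<xi> t) (momentum m (rigid_motion \<Omega> \<xi>) t)
      = u * (3/4 * (m 1 * m 2 * m 3 * (m 1 + m 2 + m 3) / (m 1 * m 2 + m 2 * m 3 + m 3 * m 1)\<^sup>2))"
proof -
  \<comment> \<open>For side \<open>1\<close> the squared angular velocity is the total mass; \<open>a\<^sup>2\<close> takes the share of it that the
    formula for \<open>k\<close> assigns to rotation within the plane of the triangle.\<close>
  define a b where "a = sqrt (sum m UNIV * (1 - u))" and "b = sqrt (sum m UNIV * u)"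
  define \<Omega> \<xi> where "\<Omega> = quaternion_rotation a b" and "\<xi> = centred_triangle m"
  have mass: "sum m UNIV > 0" by (intro sum_pos) (auto simp: pos)
  then have a: "a\<^sup>2 = sum m UNIV * (1 - u)" and b: "b\<^sup>2 = sum m UNIV * u"
    using assms(2,3) by (simp_all add: a_def b_def)
  have ab: "a\<^sup>2 + b\<^sup>2 = sum m UNIV" unfolding a b distrib_left [symmetric] by simp
  have tri: "rotating_triangle m \<Omega> \<xi> 1"
    unfolding \<Omega>_def \<xi>_def by (rule rotating_triangle_exists [of m, OF assms(1) ab])
  then interpret rotating_triangle m \<Omega> \<xi> 1 .
  interpret at: rotating_triangle m \<Omega> "rigid_motion \<Omega> \<xi> t" 1
    by (rule rotating_triangle_rigid_motion [OF tri])
  have "kaehler\<^sup>2 = a\<^sup>2 * gram"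
    unfolding \<Omega>_def \<xi>_def by (rule kaehler_centred_triangle [of m, OF assms(1) ab])
  moreover have "gram = at.gram" by (simp only: gram_eq at.gram_eq)
  moreover have "at.kaehler = kaehler" by (rule kaehler_rigid_motion [OF tri])
  ultimately have "at.kaehler\<^sup>2 = a\<^sup>2 * at.gram" by (simp only:)
  moreover have "at.w = sum m UNIV" by (simp add: at.w_def at.M_def sum_3)
  ultimately have "at.kaehler\<^sup>2 / (at.w * at.gram) = a\<^sup>2 / sum m UNIV"
    using at.gram_pos by simp
  also have "\<dots> = 1 - u" using mass unfolding a by simp
  finally have share: "1 - at.kaehler\<^sup>2 / (at.w * at.gram) = u" by simp
  have "momentum m (rigid_motion \<Omega> \<xi>) t = at.momenta"
    by (simp add: fun_eq_iff momentum_rigid_motion at.momenta_def)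
  then have "scaled_momentum (rigid_motion \<Omega> \<xi> t) (momentum m (rigid_motion \<Omega> \<xi>) t)
      = u * (3/4 * (at.M\<^sub>3 * at.M / at.M\<^sub>2\<^sup>2))"
    using at.scaled_momentum_eq unfolding share by (simp only:)
  moreover have "relative_equilibrium m \<Omega> \<xi> \<and> equilateral \<xi>"
    using equilateral_relative_equilibrium_iff [of m, OF assms(1)] tri by blast
  ultimately show ?thesis
    unfolding at.M_def at.M\<^sub>2_def at.M\<^sub>3_def by (intro exI [of _ \<Omega>] exI [of _ \<xi>] conjI) simp_all
qed

theorem theorem1:
  fixes m :: "3 \<Rightarrow> real" and M M2 M3 t :: real
  assumes "\<And>i. m i > 0"
    and "M = m 1 + m 2 + m 3"
    and "M2 = m 1 * m 2 + m 2 * m 3 + m 3 * m 1"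
    and "M3 = m 1 * m 2 * m 3"
  shows "(\<forall>\<Omega> \<xi>. relative_equilibrium m \<Omega> \<xi> \<and> equilateral \<xi> \<longrightarrow>
            scaled_energy m (rigid_motion \<Omega> \<xi> t) (momentum m (rigid_motion \<Omega> \<xi>) t)
              = - (1/2) * (M2 ^ 3 / M)) \<and>
         {scaled_momentum (rigid_motion \<Omega> \<xi> t) (momentum m (rigid_motion \<Omega> \<xi>) t) | \<Omega> \<xi>.
            relative_equilibrium m \<Omega> \<xi> \<and> equilateral \<xi>}
          = {0 .. 3/4 * (M3 * M / M2\<^sup>2)}"
proof -
  let ?K = "3/4 * (M3 * M / M2\<^sup>2)"
  let ?RE = "\<lambda>\<Omega> \<xi>. relative_equilibrium m \<Omega> \<xi> \<and> equilateral \<xi>"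
  let ?h = "\<lambda>\<Omega> \<xi>. scaled_energy m (rigid_motion \<Omega> \<xi> t) (momentum m (rigid_motion \<Omega> \<xi>) t)"
  let ?k = "\<lambda>\<Omega> \<xi>. scaled_momentum (rigid_motion \<Omega> \<xi> t) (momentum m (rigid_motion \<Omega> \<xi>) t)"
  have bounds: "?h \<Omega> \<xi> = - (1/2) * (M2 ^ 3 / M) \<and> ?k \<Omega> \<xi> \<in> {0..?K}"
    if re: "?RE \<Omega> \<xi>" for \<Omega> \<xi>
  proof -
    obtain r where "rotating_triangle m \<Omega> \<xi> r"
      using re equilateral_relative_equilibrium_iff [of m, OF assms(1)] by blast
    then interpret rotating_triangle m \<Omega> "rigid_motion \<Omega> \<xi> t" r
      by (rule rotating_triangle_rigid_motion)
    have "momentum m (rigid_motion \<Omega> \<xi>) t = momenta"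
      by (simp add: fun_eq_iff momentum_rigid_motion momenta_def)
    moreover have "M = local.M" "M2 = M\<^sub>2" "M3 = M\<^sub>3"
      unfolding assms(2-4) M_def M\<^sub>2_def M\<^sub>3_def by (rule refl)+
    ultimately show ?thesis
      using scaled_energy_eq scaled_momentum_range by (simp only: simp_thms)
  qed
  have attained: "\<exists>\<Omega> \<xi>. ?RE \<Omega> \<xi> \<and> ?k \<Omega> \<xi> = k" if k: "k \<in> {0..?K}" for k
  proof -
    have "?K > 0"
      unfolding assms(2-4)
      by (intro mult_pos_pos divide_pos_pos zero_less_power add_pos_pos assms(1)) simp_all
    moreover have "0 \<le> k / K \<and> k / K \<le> 1 \<and> k / K * K = k" if "K > 0" "k \<in> {0..K}" for K
      using that by simp
    ultimately have u: "0 \<le> k / ?K" "k / ?K \<le> 1" "k / ?K * ?K = k" using k by blast+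
    show ?thesis
      using scaled_momentum_attained [of m, OF assms(1) u(1,2), of t, folded assms(2-4)]
      unfolding u(3) by (simp only: conj_assoc)
  qed
  show ?thesis
  proof (intro conjI allI impI)
    show "?h \<Omega> \<xi> = - (1/2) * (M2 ^ 3 / M)" if "?RE \<Omega> \<xi>" for \<Omega> \<xi>
      using bounds [OF that] ..
    show "{?k \<Omega> \<xi> | \<Omega> \<xi>. ?RE \<Omega> \<xi>} = {0..?K}"
    proof (intro equalityI subsetI)
      fix k assume "k \<in> {?k \<Omega> \<xi> | \<Omega> \<xi>. ?RE \<Omega> \<xi>}"
      then obtain \<Omega> \<xi> where "k = ?k \<Omega> \<xi>" "?RE \<Omega> \<xi>" by (elim CollectE exE conjE) (rule that, blast+)
      then show "k \<in> {0..?K}" using bounds by (simp only: simp_thms)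
    next
      fix k assume "k \<in> {0..?K}"
      from attained [OF this] show "k \<in> {?k \<Omega> \<xi> | \<Omega> \<xi>. ?RE \<Omega> \<xi>}"
        by (elim exE conjE) (intro CollectI exI conjI, simp_all only:)
    qed
  qed
qed

end
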